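(* Let $\lambda>0$, $L>0$, $k=\frac{2\pi}{L}$, $U,\alpha\in\mathbb{R}$, and let $\sigma=\frac1s-\frac12$, $\sigma'=\frac1{s'}-\frac12$, where $s,s'\ne0$ are the relaxation coefficients. Let $u(x)=\lambda U\cos(kx)$ and let $\partial_u$ be the operator $\partial_u\varphi=U\,\partial_x\big(\cos(kx)\,\varphi\big)$. For the D1Q3 lattice Boltzmann scheme with this velocity field, the linear differential operators $\alpha_1,\dots,\alpha_4,\beta_1,\beta_2,\beta_3$ (defined recursively in the context) admit the following expressions in terms of the operators $\partial_x$ and $\partial_u$: $$\alpha_1=\lambda\,\partial_u,\qquad \beta_1=\lambda^2\begin{pmatrix}\frac u\lambda\,\partial_u-\frac{\alpha+2}3\,\partial_x\\ \lambda(\alpha-1)\,\partial_u\end{pmatrix},$$ $$\alpha_2=\lambda^2\sigma\Big(\partial_u^2-\tfrac{\alpha+2}3\,\partial_x^2\Big),$$ $$\beta_2=\lambda^3\begin{pmatrix}2\sigma\frac u\lambda\,\partial_u^2-\big(\frac{\alpha+2}3\sigma+\frac{\alpha-1}3\sigma'\big)\partial_x\partial_u-\frac{\alpha+2}3\,\sigma\frac u\lambda\,\partial_x^2\\ \lambda(\alpha-1)\big((\sigma+\sigma')\,\partial_u^2-\frac{\alpha+2}3\,\sigma\,\partial_x^2\big)\end{pmatrix},$$ $$\alpha_3=\lambda^3\Big[\big(2\sigma^2-\tfrac16\big)\partial_u^3+\Big(\tfrac{\alpha+2}3\big(\tfrac16-\sigma^2\big)+\tfrac{\alpha-1}3\big(\tfrac1{12}-\sigma\sigma'\big)\Big)\partial_x^2\,\partial_u-\tfrac{\alpha+2}3\,\sigma^2\,\partial_u\,\partial_x^2\Big],$$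 $$\beta_3=\begin{pmatrix}\lambda^4\beta_{3J}\\ \lambda^5\beta_{3e}\end{pmatrix},$$ with $$\begin{aligned} \beta_{3J}&=\tfrac{\alpha+2}9\big[-(1-\alpha)\sigma\sigma'+(\alpha+2)\sigma^2+\tfrac14\big]\partial_x^3\\ &\quad+\tfrac u\lambda\big[-2\,\tfrac{\alpha+2}3\sigma^2+\tfrac{1-\alpha}3\sigma\sigma'+\tfrac{1+\alpha}{12}\big]\partial_x^2\,\partial_u-2\,\tfrac u\lambda\,\tfrac{\alpha+2}3\,\sigma^2\,\partial_u\,\partial_x^2\\ &\quad+\big[-2\,\tfrac{\alpha+2}3\sigma^2+\tfrac{1-\alpha}3\big(2\sigma\sigma'+\sigma'^2-\tfrac14\big)\big]\partial_x\,\partial_u^2+\big(5\sigma^2-\tfrac14\big)\tfrac u\lambda\,\partial_u^3,\\ \beta_{3e}&=\tfrac{1-\alpha}3\big[(\alpha+2)\sigma^2+(1+2\alpha)\sigma\sigma'-\tfrac{1+\alpha}4\big]\partial_x^2\,\partial_u+(1-\alpha)\tfrac{\alpha+2}3\,\sigma(\sigma+\sigma')\,\partial_u\,\partial_x^2\\ &\quad-(1-\alpha)\big(2\sigma^2+2\sigma\sigma'+\sigma'^2-\tfrac14\big)\partial_u^3, \end{aligned}$$ and $$\begin{aligned} \alpha_4=\lambda^4\Big[&\tfrac{\alpha+2}9\big((\alpha+2)\sigma^3-(1-\alpha)\sigma^2\sigma'-\tfrac\alpha4\sigma\big)\partial_x^4\\ &+\big[-2\,\tfrac{\alpha+2}3\sigma^3+\tfrac{1-\alpha}3\big(2\sigma^2\sigma'+\sigma\sigma'^2-\tfrac14\sigma'\big)+\tfrac{1+2\alpha}9\sigma\big]\partial_x^2\,\partial_u^2\\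 &+\big[-2\,\tfrac{\alpha+2}3\sigma^3+\tfrac{1-\alpha}3\sigma^2\sigma'+\tfrac{7+5\alpha}{36}\sigma\big]\partial_u\,\partial_x^2\,\partial_u\\ &+\tfrac{\alpha+2}3\,\sigma\big(-2\sigma^2+\tfrac16\big)\partial_u^2\,\partial_x^2+\sigma\big(5\sigma^2-\tfrac34\big)\partial_u^4\Big]. \end{aligned}$$
   Context: All operators act on smooth scalar functions of $x\in\mathbb{R}$; products of operators are compositions (note that $\partial_x$ and $\partial_u$ do not commute), and a function such as $u/\lambda=U\cos(kx)$ placed to the left of an operator acts by multiplication after it. The real number $\alpha$ (a coefficient of the equilibrium) is not to be confused with the operators $\alpha_j$. Data of the D1Q3 scheme (moments: density $\rho$, conserved; momentum $J$ and energy $e$, non-conserved): $$E(x)=\begin{pmatrix}\lambda U\cos(kx)\\ \lambda^2\alpha\end{pmatrix},\qquad \delta\varphi=\partial_x\big(E(x)\varphi\big),\ \text{ i.e. }\ \delta=\begin{pmatrix}\lambda\,\partial_u\\ \lambda^2\alpha\,\partial_x\end{pmatrix},\qquad \Sigma=\begin{pmatrix}\sigma&0\\0&\sigma'\end{pmatrix},$$ $$\overline A=0,\qquad \overline B=\begin{pmatrix}1&0\end{pmatrix},\qquad \overline C=\begin{pmatrix}\frac{2\lambda^2}3\\0\end{pmatrix},\qquad \overline D=\begin{pmatrix}0&\frac13\\ \lambda^2&0\end{pmatrix},$$ $$\overline{B_2}=\overline A\,\overline B+\overline B\,\overline D,\qquad \overline{D_2}=\overline C\,\overline B+\overline D^{\,2}.$$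 The operators $\alpha_j$ (scalar) and $\beta_j$ (two-component column) are defined recursively by $$\begin{aligned} \alpha_1&=\overline A\,\partial_x+\overline B\,\delta,\\ \beta_1&=E\,\alpha_1-(\overline C\,\partial_x+\overline D\,\delta),\\ \alpha_2&=\overline B\,\Sigma\,\partial_x\,\beta_1,\\ \beta_2&=\Sigma\,\beta_1\,\alpha_1+E\,\alpha_2-\overline D\,\Sigma\,\partial_x\,\beta_1,\\ \alpha_3&=\overline B\,\Sigma\,\partial_x\,\beta_2+\tfrac1{12}\overline{B_2}\,\partial_x^2\,\beta_1-\tfrac16\overline B\,\partial_x\,\beta_1\,\alpha_1,\\ \beta_3&=\Sigma\,\beta_1\,\alpha_2+E\,\alpha_3-\overline D\,\Sigma\,\partial_x\,\beta_2+\Sigma\,\beta_2\,\alpha_1+\tfrac16\overline D\,\partial_x\,\beta_1\,\alpha_1-\tfrac1{12}\beta_1\,\alpha_1^2-\tfrac1{12}\overline{D_2}\,\partial_x^2\,\beta_1,\\ \alpha_4&=\overline B\,\Sigma\,\partial_x\,\beta_3+\tfrac14\overline{B_2}\,\partial_x^2\,\beta_2+\tfrac16\overline B\,\overline{D_2}\,\Sigma\,\partial_x^3\,\beta_1-\tfrac16\overline A\,\overline B\,\partial_x^2\,\beta_2\\ &\quad-\tfrac16\overline B\,\delta\,\alpha_1\,\alpha_2-\tfrac16\overline B\,\delta\,\alpha_2\,\alpha_1-\tfrac16\overline B\,\Sigma\,\partial_x\,\beta_1\,\alpha_1^2 . \end{aligned}$$ *)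

theory Defs
  imports "HOL-Analysis.Analysis"
begin

definition smooth :: "(real \<Rightarrow> real) \<Rightarrow> bool" where
  "smooth f \<longleftrightarrow> (\<forall>n x. (deriv ^^ n) f differentiable (at x))"

abbreviation dx :: "(real \<Rightarrow> real) \<Rightarrow> real \<Rightarrow> real" where
  "dx \<equiv> deriv"

definition col_dx :: "(real \<Rightarrow> real^2) \<Rightarrow> real \<Rightarrow> real^2" where
  "col_dx F = (\<lambda>x. \<chi> i. deriv (\<lambda>y. F y $ i) x)"

definition du :: "real \<Rightarrow> real \<Rightarrow> (real \<Rightarrow> real) \<Rightarrow> real \<Rightarrow> real" where
  "du U k \<phi> = (\<lambda>x. U * dx (\<lambda>y. cos (k * y) * \<phi> y) x)"

text \<open>
  Data of a linear scheme in one space dimension with one conserved and two non-conserved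
  moments: the equilibrium \<open>E(x)\<close>, the matrix \<open>\<Sigma>\<close>, and the constant blocks \<open>A\<close> (1 by 1),
  \<open>B\<close> (1 by 2), \<open>C\<close> (2 by 1), \<open>D\<close> (2 by 2).  A 1 by 1 block is a real number; a row or a column
  of length 2 is an element of \<open>real^2\<close>, so that a row applied to a column is the inner product.
\<close>

record scheme =
  eqE  :: "real \<Rightarrow> real^2"
  relS :: "real^2^2"
  blkA :: real
  blkB :: "real^2"
  blkC :: "real^2"
  blkD :: "real^2^2"

definition blkB2 :: "scheme \<Rightarrow> real^2" where
  "blkB2 S = blkA S *\<^sub>R blkB S + blkB S v* blkD S"

text \<open>The first summand is the product of the column \<open>C\<close> with the row \<open>B\<close>.\<close>

definition blkD2 :: "scheme \<Rightarrow> real^2^2" where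
  "blkD2 S = (\<chi> i j. blkC S $ i * blkB S $ j) + blkD S ** blkD S"

definition delta :: "scheme \<Rightarrow> (real \<Rightarrow> real) \<Rightarrow> real \<Rightarrow> real^2" where
  "delta S \<phi> = col_dx (\<lambda>x. \<phi> x *\<^sub>R eqE S x)"

text \<open>
  Operators act on functions, and products of operators are compositions: for instance
  \<open>\<beta>\<^sub>1 \<alpha>\<^sub>1\<close> applied to \<open>\<phi>\<close> is \<open>beta1 S (alpha1 S \<phi>)\<close>, and \<open>E \<alpha>\<^sub>1\<close> applied to \<open>\<phi>\<close> is
  \<open>\<lambda>x. alpha1 S \<phi> x *\<^sub>R eqE S x\<close>.
\<close>

definition alpha1 :: "scheme \<Rightarrow> (real \<Rightarrow> real) \<Rightarrow> real \<Rightarrow> real" where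
  "alpha1 S \<phi> = (\<lambda>x. blkA S * dx \<phi> x + blkB S \<bullet> delta S \<phi> x)"

definition beta1 :: "scheme \<Rightarrow> (real \<Rightarrow> real) \<Rightarrow> real \<Rightarrow> real^2" where
  "beta1 S \<phi> = (\<lambda>x. alpha1 S \<phi> x *\<^sub>R eqE S x
     - (dx \<phi> x *\<^sub>R blkC S + blkD S *v delta S \<phi> x))"

definition alpha2 :: "scheme \<Rightarrow> (real \<Rightarrow> real) \<Rightarrow> real \<Rightarrow> real" where
  "alpha2 S \<phi> = (\<lambda>x. blkB S \<bullet> (relS S *v col_dx (beta1 S \<phi>) x))"

definition beta2 :: "scheme \<Rightarrow> (real \<Rightarrow> real) \<Rightarrow> real \<Rightarrow> real^2" where
  "beta2 S \<phi> = (\<lambda>x. relS S *v beta1 S (alpha1 S \<phi>) x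
     + alpha2 S \<phi> x *\<^sub>R eqE S x
     - blkD S *v (relS S *v col_dx (beta1 S \<phi>) x))"

definition alpha3 :: "scheme \<Rightarrow> (real \<Rightarrow> real) \<Rightarrow> real \<Rightarrow> real" where
  "alpha3 S \<phi> = (\<lambda>x. blkB S \<bullet> (relS S *v col_dx (beta2 S \<phi>) x)
     + 1/12 * (blkB2 S \<bullet> (col_dx ^^ 2) (beta1 S \<phi>) x)
     - 1/6 * (blkB S \<bullet> col_dx (beta1 S (alpha1 S \<phi>)) x))"

definition beta3 :: "scheme \<Rightarrow> (real \<Rightarrow> real) \<Rightarrow> real \<Rightarrow> real^2" where
  "beta3 S \<phi> = (\<lambda>x. relS S *v beta1 S (alpha2 S \<phi>) x
     + alpha3 S \<phi> x *\<^sub>R eqE S x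
     - blkD S *v (relS S *v col_dx (beta2 S \<phi>) x)
     + relS S *v beta2 S (alpha1 S \<phi>) x
     + (1/6) *\<^sub>R (blkD S *v col_dx (beta1 S (alpha1 S \<phi>)) x)
     - (1/12) *\<^sub>R beta1 S (alpha1 S (alpha1 S \<phi>)) x
     - (1/12) *\<^sub>R (blkD2 S *v (col_dx ^^ 2) (beta1 S \<phi>) x))"

definition alpha4 :: "scheme \<Rightarrow> (real \<Rightarrow> real) \<Rightarrow> real \<Rightarrow> real" where
  "alpha4 S \<phi> = (\<lambda>x. blkB S \<bullet> (relS S *v col_dx (beta3 S \<phi>) x)
     + 1/4 * (blkB2 S \<bullet> (col_dx ^^ 2) (beta2 S \<phi>) x)
     + 1/6 * (blkB S \<bullet> (blkD2 S *v (relS S *v (col_dx ^^ 3) (beta1 S \<phi>) x)))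
     - 1/6 * (blkA S * (blkB S \<bullet> (col_dx ^^ 2) (beta2 S \<phi>) x))
     - 1/6 * (blkB S \<bullet> delta S (alpha1 S (alpha2 S \<phi>)) x)
     - 1/6 * (blkB S \<bullet> delta S (alpha2 S (alpha1 S \<phi>)) x)
     - 1/6 * (blkB S \<bullet> (relS S *v col_dx (beta1 S (alpha1 S (alpha1 S \<phi>))) x)))"

text \<open>
  The two non-conserved moments are the momentum (index 1) and the energy (index 2);
  matrices are listed row by row.
\<close>

definition d1q3 :: "real \<Rightarrow> real \<Rightarrow> real \<Rightarrow> real \<Rightarrow> real \<Rightarrow> real \<Rightarrow> scheme" where
  "d1q3 lam U k \<alpha> \<sigma> \<sigma>' = \<lparr>
     eqE = (\<lambda>x. vector [lam * U * cos (k * x), lam\<^sup>2 * \<alpha>]),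
     relS = vector [vector [\<sigma>, 0], vector [0, \<sigma>']],
     blkA = 0,
     blkB = vector [1, 0],
     blkC = vector [2 * lam\<^sup>2 / 3, 0],
     blkD = vector [vector [0, 1/3], vector [lam\<^sup>2, 0]] \<rparr>"

end

theory Submission
  imports Defs
begin

text \<open>
  Write \<open>X = \<partial>\<^sub>x\<close> and let \<open>V\<close> be multiplication by the normalised velocity \<open>u / \<lambda>\<close>.  On smooth
  functions both are linear operators, \<open>\<partial>\<^sub>u\<close> is the composite \<open>X V\<close>, and the recursion builds every
  \<open>\<alpha>\<^sub>j\<close> and every component of every \<open>\<beta>\<^sub>j\<close> from \<open>X\<close> and \<open>V\<close> by sums, scalar multiples and
  composition.  The claimed formulas hold already in the free associative algebra on \<open>X\<close> and \<open>V\<close>,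
  so they can be verified by expanding both sides into words, without ever commuting \<open>X\<close> past \<open>V\<close>.

  The reason that the \<open>\<alpha>\<^sub>j\<close> can be written with \<open>X\<close> and \<open>D = X V\<close> alone is that a factor \<open>V\<close> without
  an \<open>X\<close> directly to its left arises only from the first entry of the equilibrium.  Hence each
  momentum component has the form \<open>P + V Q\<close>, and each energy component the form \<open>P\<close>, with \<open>P\<close> and
  \<open>Q\<close> polynomials in \<open>X\<close> and \<open>D\<close>.  In the \<open>\<alpha>\<^sub>j\<close> the momentum components stand behind an \<open>X\<close>, and
  \<open>X (P + V Q) = X P + D Q\<close>.

  Two ingredients turn this into a proof.  Smooth functions are closed under the operations
  involved (\<open>smooth_coinduct\<close> and its consequences), so that linearity of differentiation is always
  applicable; and the matrix recursion is spelled out as a scalar recursion for the components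
  (\<open>alpha1_rec\<close> up to \<open>alpha4_rec\<close>).  Substituting each closed form into the next recursion
  step leaves a polynomial identity in \<open>\<lambda>, \<alpha>, \<sigma>, \<sigma>'\<close> for the coefficient of each word in \<open>X\<close>
  and \<open>D\<close>.
\<close>

section \<open>The algebra of smooth functions\<close>

lemma smooth_differentiable: "smooth f \<Longrightarrow> f differentiable (at x)"
  unfolding smooth_def by (metis funpow_0)

lemma smooth_deriv:
  assumes "smooth f"
  shows "smooth (deriv f)"
  unfolding smooth_def
proof (intro allI)
  fix n x
  have "(deriv ^^ Suc n) f differentiable (at x)"
    using assms unfolding smooth_def by blast
  then show "(deriv ^^ n) (deriv f) differentiable (at x)"
    by (simp add: funpow_swap1)
qed

lemma smooth_has_deriv: "smooth f \<Longrightarrow> (f has_real_derivative deriv f x) (at x)"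
  using smooth_differentiable DERIV_deriv_iff_real_differentiable by blast

text \<open>
  A class of differentiable functions that is closed under differentiation consists of smooth
  functions.  This replaces formulas for iterated derivatives in all closure properties: a suitable
  class takes their place.
\<close>

lemma smooth_coinduct:
  assumes "P f"
    and step: "\<And>g. P g \<Longrightarrow> \<exists>g'. P g' \<and> (\<forall>x. (g has_real_derivative g' x) (at x))"
  shows "smooth f"
  unfolding smooth_def
proof (intro allI)
  fix n x
  have deriv: "P (deriv g)" if g: "P g" for g
  proof -
    obtain g' where g': "P g'" "\<forall>x. (g has_real_derivative g' x) (at x)"
      using step[OF g] by blast
    then have "deriv g = g'"
      by (auto intro: DERIV_imp_deriv)
    with g'(1) show ?thesis by simp
  qed
  have "P ((deriv ^^ n) f)"
    by (induction n) (simp_all add: \<open>P f\<close> deriv)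
  from step[OF this] show "(deriv ^^ n) f differentiable (at x)"
    using real_differentiable_def by blast
qed

lemma smooth_const: "smooth (\<lambda>x. c)"
proof (rule smooth_coinduct[where P = "\<lambda>g. \<exists>c. g = (\<lambda>x. c)"])
  fix g :: "real \<Rightarrow> real"
  assume "\<exists>c. g = (\<lambda>x. c)"
  then have "(g has_real_derivative 0) (at x)" for x
    by auto
  then show "\<exists>g'. (\<exists>c. g' = (\<lambda>x. c)) \<and> (\<forall>x. (g has_real_derivative g' x) (at x))"
    by (intro exI[of _ "\<lambda>x. 0"]) auto
qed blast

lemma smooth_cos: "smooth (\<lambda>x. cos (k * x))"
proof (rule smooth_coinduct[where P = "\<lambda>g. \<exists>a b. g = (\<lambda>x. a * cos (k * x) + b * sin (k * x))"])
  show "\<exists>a b. (\<lambda>x. cos (k * x)) = (\<lambda>x. a * cos (k * x) + b * sin (k * x))"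
    by (rule exI[of _ 1], rule exI[of _ 0]) simp
next
  fix g assume "\<exists>a b. g = (\<lambda>x. a * cos (k * x) + b * sin (k * x))"
  then obtain a b where g: "g = (\<lambda>x. a * cos (k * x) + b * sin (k * x))" by blast
  have "(g has_real_derivative (b * k) * cos (k * x) + (- a * k) * sin (k * x)) (at x)" for x
    unfolding g by (auto intro!: derivative_eq_intros simp: algebra_simps)
  then show "\<exists>g'. (\<exists>a b. g' = (\<lambda>x. a * cos (k * x) + b * sin (k * x))) \<and>
      (\<forall>x. (g has_real_derivative g' x) (at x))"
    by blast
qed

text \<open>
  Products alone are not closed under differentiation, but sums of products are, by the Leibniz
  rule.  This one class therefore yields the closure of smooth functions under both operations.
\<close>

inductive sum_of_products :: "(real \<Rightarrow> real) \<Rightarrow> bool" where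
  product: "smooth f \<Longrightarrow> smooth g \<Longrightarrow> sum_of_products (\<lambda>x. f x * g x)"
| sum: "sum_of_products f \<Longrightarrow> sum_of_products g \<Longrightarrow> sum_of_products (\<lambda>x. f x + g x)"

lemma sum_of_products_smooth: "sum_of_products f \<Longrightarrow> smooth f"
proof (erule smooth_coinduct)
  fix g assume "sum_of_products g"
  then show "\<exists>g'. sum_of_products g' \<and> (\<forall>x. (g has_real_derivative g' x) (at x))"
  proof induction
    case (product f g)
    have "sum_of_products (\<lambda>x. deriv f x * g x + f x * deriv g x)"
      using product by (intro sum_of_products.intros smooth_deriv)
    moreover have "((\<lambda>x. f x * g x) has_real_derivative deriv f x * g x + f x * deriv g x) (at x)" for x
      using DERIV_mult[OF smooth_has_deriv smooth_has_deriv, OF product]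
      by (simp add: algebra_simps)
    ultimately show ?case by blast
  next
    case (sum f g)
    then obtain f' g' where "sum_of_products f'" "sum_of_products g'"
      and "\<And>x. (f has_real_derivative f' x) (at x)" "\<And>x. (g has_real_derivative g' x) (at x)"
      by blast
    then have "sum_of_products (\<lambda>x. f' x + g' x) \<and>
        (\<forall>x. ((\<lambda>x. f x + g x) has_real_derivative f' x + g' x) (at x))"
      by (auto intro: sum_of_products.intros DERIV_add)
    then show ?case by blast
  qed
qed

lemma smooth_mult: "smooth f \<Longrightarrow> smooth g \<Longrightarrow> smooth (\<lambda>x. f x * g x)"
  using sum_of_products_smooth[OF sum_of_products.product] .

lemma smooth_add:
  assumes "smooth f" "smooth g"
  shows "smooth (\<lambda>x. f x + g x)"
proof -
  have "sum_of_products (\<lambda>x. 1 * f x + 1 * g x)"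
    by (intro sum_of_products.intros smooth_const assms)
  then show ?thesis
    using sum_of_products_smooth by simp
qed

lemma smooth_diff: "smooth f \<Longrightarrow> smooth g \<Longrightarrow> smooth (\<lambda>x. f x - g x)"
  using smooth_add[of f "\<lambda>x. - 1 * g x"] smooth_mult[OF smooth_const[of "-1"]] by simp

lemmas smooth_intros = smooth_const smooth_add smooth_diff smooth_mult smooth_deriv

lemma dx_add: "smooth f \<Longrightarrow> smooth g \<Longrightarrow> dx (\<lambda>x. f x + g x) = (\<lambda>x. dx f x + dx g x)"
  by (intro ext DERIV_imp_deriv DERIV_add smooth_has_deriv)

lemma dx_diff: "smooth f \<Longrightarrow> smooth g \<Longrightarrow> dx (\<lambda>x. f x - g x) = (\<lambda>x. dx f x - dx g x)"
  by (intro ext DERIV_imp_deriv DERIV_diff smooth_has_deriv)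

lemma dx_cmult: "smooth f \<Longrightarrow> dx (\<lambda>x. c * f x) = (\<lambda>x. c * dx f x)"
  by (intro ext DERIV_imp_deriv DERIV_cmult smooth_has_deriv)


section \<open>The recursion, component by component\<close>

lemma col_dx_nth: "col_dx F x $ i = dx (\<lambda>y. F y $ i) x"
  by (simp add: col_dx_def)

lemma col_dx_funpow_nth: "(col_dx ^^ n) F x $ i = (dx ^^ n) (\<lambda>y. F y $ i) x"
  by (induction n arbitrary: x) (simp_all add: col_dx_nth)

text \<open>
  The D1Q3 scheme with an arbitrary smooth velocity \<open>\<lambda> V\<close> in place of the cosine: keeping \<open>V\<close> opaque
  makes it a free generator in the calculations.
\<close>

locale d1q3_flow =
  fixes lam \<alpha> \<sigma> \<sigma>' :: real and V :: "real \<Rightarrow> real" and S :: scheme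
  assumes smooth_V: "smooth V"
    and S_eq: "S = \<lparr>
     eqE = (\<lambda>x. vector [lam * V x, lam\<^sup>2 * \<alpha>]),
     relS = vector [vector [\<sigma>, 0], vector [0, \<sigma>']],
     blkA = 0,
     blkB = vector [1, 0],
     blkC = vector [2 * lam\<^sup>2 / 3, 0],
     blkD = vector [vector [0, 1/3], vector [lam\<^sup>2, 0]] \<rparr>"
begin

text \<open>This is the operator \<open>\<partial>\<^sub>u\<close> for a general velocity.\<close>

definition D :: "(real \<Rightarrow> real) \<Rightarrow> real \<Rightarrow> real" where
  "D f = dx (\<lambda>x. V x * f x)"

text \<open>
  The momentum (J) and energy (e) components are named as scalar operators in their own right, so
  that their closed forms can be used for rewriting under \<open>dx\<close>.
\<close>

definition beta1J where "beta1J \<phi> = (\<lambda>x. beta1 S \<phi> x $ 1)"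
definition beta1e where "beta1e \<phi> = (\<lambda>x. beta1 S \<phi> x $ 2)"
definition beta2J where "beta2J \<phi> = (\<lambda>x. beta2 S \<phi> x $ 1)"
definition beta2e where "beta2e \<phi> = (\<lambda>x. beta2 S \<phi> x $ 2)"
definition beta3J where "beta3J \<phi> = (\<lambda>x. beta3 S \<phi> x $ 1)"
definition beta3e where "beta3e \<phi> = (\<lambda>x. beta3 S \<phi> x $ 2)"

lemma data_simps:
  "eqE S x $ 1 = lam * V x" "eqE S x $ 2 = lam\<^sup>2 * \<alpha>"
  "relS S $ 1 $ 1 = \<sigma>" "relS S $ 1 $ 2 = 0" "relS S $ 2 $ 1 = 0" "relS S $ 2 $ 2 = \<sigma>'"
  "blkA S = 0" "blkB S $ 1 = 1" "blkB S $ 2 = 0"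
  "blkC S $ 1 = 2 * lam\<^sup>2 / 3" "blkC S $ 2 = 0"
  "blkD S $ 1 $ 1 = 0" "blkD S $ 1 $ 2 = 1/3" "blkD S $ 2 $ 1 = lam\<^sup>2" "blkD S $ 2 $ 2 = 0"
  by (simp_all add: S_eq vector_2)

lemmas component_simps = data_simps inner_vec_def matrix_vector_mult_def vector_matrix_mult_def
  matrix_matrix_mult_def blkB2_def blkD2_def sum_2 col_dx_nth col_dx_funpow_nth

lemmas component_defs = beta1J_def beta1e_def beta2J_def beta2e_def beta3J_def beta3e_def

text \<open>
  Since \<open>B\<close> selects the momentum, \<open>\<Sigma>\<close> is diagonal and the block \<open>D\<close> exchanges the two moments,
  each matrix product reduces to one term per component.  The constants in front of second and
  third derivatives come from \<open>B\<^sub>2 = (0, 1/3)\<close> and \<open>D\<^sub>2 = diag (\<lambda>\<^sup>2, \<lambda>\<^sup>2/3)\<close>.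
\<close>

lemma delta_J: "delta S \<phi> x $ 1 = dx (\<lambda>x. \<phi> x * (lam * V x)) x"
  and delta_e: "delta S \<phi> x $ 2 = dx (\<lambda>x. \<phi> x * (lam\<^sup>2 * \<alpha>)) x"
  by (simp_all add: delta_def component_simps)

lemma alpha1_rec: "alpha1 S \<phi> x = delta S \<phi> x $ 1"
  by (simp add: alpha1_def component_simps)

lemma beta1J_rec: "beta1J \<phi> x =
    alpha1 S \<phi> x * (lam * V x) - (2 * lam\<^sup>2 / 3 * dx \<phi> x + 1/3 * delta S \<phi> x $ 2)"
  and beta1e_rec: "beta1e \<phi> x = alpha1 S \<phi> x * (lam\<^sup>2 * \<alpha>) - lam\<^sup>2 * delta S \<phi> x $ 1"
  by (simp_all add: component_defs beta1_def component_simps)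

lemma alpha2_rec: "alpha2 S \<phi> x = \<sigma> * dx (beta1J \<phi>) x"
  by (simp add: alpha2_def component_simps component_defs)

lemma beta2J_rec: "beta2J \<phi> x = \<sigma> * beta1J (alpha1 S \<phi>) x + alpha2 S \<phi> x * (lam * V x)
    - 1/3 * (\<sigma>' * dx (beta1e \<phi>) x)"
  and beta2e_rec: "beta2e \<phi> x = \<sigma>' * beta1e (alpha1 S \<phi>) x + alpha2 S \<phi> x * (lam\<^sup>2 * \<alpha>)
    - lam\<^sup>2 * (\<sigma> * dx (beta1J \<phi>) x)"
  by (simp_all add: component_defs beta2_def component_simps)

lemma alpha3_rec: "alpha3 S \<phi> x = \<sigma> * dx (beta2J \<phi>) x + 1/36 * dx (dx (beta1e \<phi>)) x
    - 1/6 * dx (beta1J (alpha1 S \<phi>)) x"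
  by (simp add: alpha3_def component_defs component_simps numeral_2_eq_2)

lemma beta3J_rec: "beta3J \<phi> x = \<sigma> * beta1J (alpha2 S \<phi>) x + alpha3 S \<phi> x * (lam * V x)
    - 1/3 * (\<sigma>' * dx (beta2e \<phi>) x) + \<sigma> * beta2J (alpha1 S \<phi>) x
    + 1/18 * dx (beta1e (alpha1 S \<phi>)) x - 1/12 * beta1J (alpha1 S (alpha1 S \<phi>)) x
    - lam\<^sup>2 / 12 * dx (dx (beta1J \<phi>)) x"
  and beta3e_rec: "beta3e \<phi> x = \<sigma>' * beta1e (alpha2 S \<phi>) x + alpha3 S \<phi> x * (lam\<^sup>2 * \<alpha>)
    - lam\<^sup>2 * (\<sigma> * dx (beta2J \<phi>) x) + \<sigma>' * beta2e (alpha1 S \<phi>) x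
    + lam\<^sup>2 / 6 * dx (beta1J (alpha1 S \<phi>)) x - 1/12 * beta1e (alpha1 S (alpha1 S \<phi>)) x
    - lam\<^sup>2 / 36 * dx (dx (beta1e \<phi>)) x"
  by (simp_all add: component_defs beta3_def component_simps numeral_2_eq_2)

lemma alpha4_rec: "alpha4 S \<phi> x = \<sigma> * dx (beta3J \<phi>) x + 1/12 * dx (dx (beta2e \<phi>)) x
    + lam\<^sup>2 * \<sigma> / 6 * dx (dx (dx (beta1J \<phi>))) x
    - 1/6 * alpha1 S (alpha1 S (alpha2 S \<phi>)) x - 1/6 * alpha1 S (alpha2 S (alpha1 S \<phi>)) x
    - \<sigma> / 6 * dx (beta1J (alpha1 S (alpha1 S \<phi>))) x"
  by (simp add: alpha4_def alpha1_rec component_defs component_simps numeral_2_eq_2 numeral_3_eq_3)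


section \<open>Closed forms\<close>

lemma smooth_D: "smooth f \<Longrightarrow> smooth (D f)"
  unfolding D_def by (intro smooth_intros smooth_V)

text \<open>
  Used from left to right, this absorbs a leftmost \<open>V\<close> into \<open>D\<close> as soon as \<open>dx\<close> is applied, so that
  the results of the calculations are words in \<open>dx\<close> and \<open>D\<close>.
\<close>

lemma dx_V: "dx (\<lambda>x. V x * f x) = D f"
  by (simp add: D_def)

lemma D_diff: "smooth f \<Longrightarrow> smooth g \<Longrightarrow> D (\<lambda>x. f x - g x) = (\<lambda>x. D f x - D g x)"
  unfolding D_def by (simp add: right_diff_distrib dx_diff smooth_mult smooth_V)

lemma D_cmult: "smooth f \<Longrightarrow> D (\<lambda>x. c * f x) = (\<lambda>x. c * D f x)"
  unfolding D_def using dx_cmult[of "\<lambda>x. V x * f x" c]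
  by (simp add: mult.left_commute smooth_mult smooth_V)

lemmas operator_simps = smooth_intros smooth_V smooth_D
  dx_V dx_add dx_diff dx_cmult D_diff D_cmult

text \<open>
  The closed forms are stated as equations between functions, not pointwise, because in later steps
  they are substituted inside \<open>dx\<close> and inside the operators themselves.
  Powers are written as iterated applications, so that distinct words in \<open>dx\<close> and \<open>D\<close> are distinct
  atoms for the ring normalisation.
\<close>

lemma alpha1_closed: "smooth \<phi> \<Longrightarrow> alpha1 S \<phi> = (\<lambda>x. lam * D \<phi> x)"
  by (simp add: fun_eq_iff alpha1_rec delta_J mult.commute[of "\<phi> _"] mult.assoc operator_simps)

lemma delta_e_closed: "smooth \<phi> \<Longrightarrow> delta S \<phi> x $ 2 = lam\<^sup>2 * \<alpha> * dx \<phi> x"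
  by (simp add: delta_e mult.commute[of "\<phi> _"] operator_simps)

lemma beta1J_closed: "smooth \<phi> \<Longrightarrow>
    beta1J \<phi> = (\<lambda>x. lam\<^sup>2 * (V x * D \<phi> x - (\<alpha> + 2) / 3 * dx \<phi> x))"
  and beta1e_closed: "smooth \<phi> \<Longrightarrow> beta1e \<phi> = (\<lambda>x. lam^3 * ((\<alpha> - 1) * D \<phi> x))"
  unfolding fun_eq_iff beta1J_rec beta1e_rec alpha1_rec[symmetric]
  by (simp_all add: alpha1_closed delta_e_closed field_simps power2_eq_square power3_eq_cube)

lemma alpha2_closed: "smooth \<phi> \<Longrightarrow>
    alpha2 S \<phi> = (\<lambda>x. lam\<^sup>2 * (\<sigma> * (D (D \<phi>) x - (\<alpha> + 2) / 3 * dx (dx \<phi>) x)))"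
  by (simp only: fun_eq_iff alpha2_rec beta1J_closed operator_simps) simp

lemmas forms1 = alpha1_closed beta1J_closed beta1e_closed alpha2_closed

lemma beta2J_closed: "smooth \<phi> \<Longrightarrow> beta2J \<phi> = (\<lambda>x. lam^3 * (2 * \<sigma> * (V x * D (D \<phi>) x)
    - ((\<alpha> + 2) / 3 * \<sigma> + (\<alpha> - 1) / 3 * \<sigma>') * dx (D \<phi>) x
    - (\<alpha> + 2) / 3 * \<sigma> * (V x * dx (dx \<phi>) x)))"
  by (simp only: fun_eq_iff beta2J_rec forms1 operator_simps)
    (simp add: field_simps power2_eq_square power3_eq_cube)

lemma beta2e_closed: "smooth \<phi> \<Longrightarrow> beta2e \<phi> = (\<lambda>x. lam^4 * ((\<alpha> - 1) *
    ((\<sigma> + \<sigma>') * D (D \<phi>) x - (\<alpha> + 2) / 3 * \<sigma> * dx (dx \<phi>) x)))"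
  by (simp only: fun_eq_iff beta2e_rec forms1 operator_simps)
    (simp add: field_simps power2_eq_square power3_eq_cube power4_eq_xxxx)

lemma alpha3_closed: "smooth \<phi> \<Longrightarrow> alpha3 S \<phi> = (\<lambda>x. lam^3 * (
    (2 * \<sigma>^2 - 1/6) * D (D (D \<phi>)) x
    + ((\<alpha> + 2) / 3 * (1/6 - \<sigma>^2) + (\<alpha> - 1) / 3 * (1/12 - \<sigma> * \<sigma>')) * dx (dx (D \<phi>)) x
    - (\<alpha> + 2) / 3 * \<sigma>^2 * D (dx (dx \<phi>)) x))"
  by (simp only: fun_eq_iff alpha3_rec forms1 beta2J_closed operator_simps)
    (simp add: field_simps power2_eq_square power3_eq_cube)

lemmas forms2 = forms1 beta2J_closed beta2e_closed alpha3_closed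

lemma beta3J_closed: "smooth \<phi> \<Longrightarrow> beta3J \<phi> = (\<lambda>x. lam^4 * (
    (\<alpha> + 2) / 9 * (- (1 - \<alpha>) * \<sigma> * \<sigma>' + (\<alpha> + 2) * \<sigma>^2 + 1/4) * dx (dx (dx \<phi>)) x
    + (- 2 * ((\<alpha> + 2) / 3) * \<sigma>^2 + (1 - \<alpha>) / 3 * \<sigma> * \<sigma>' + (1 + \<alpha>) / 12)
        * (V x * dx (dx (D \<phi>)) x)
    - 2 * ((\<alpha> + 2) / 3) * \<sigma>^2 * (V x * D (dx (dx \<phi>)) x)
    + (- 2 * ((\<alpha> + 2) / 3) * \<sigma>^2 + (1 - \<alpha>) / 3 * (2 * \<sigma> * \<sigma>' + \<sigma>'^2 - 1/4)) * dx (D (D \<phi>)) x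
    + (5 * \<sigma>^2 - 1/4) * (V x * D (D (D \<phi>)) x)))"
  by (simp only: fun_eq_iff beta3J_rec forms2 operator_simps)
    (simp add: field_simps power2_eq_square power3_eq_cube power4_eq_xxxx)

lemma beta3e_closed: "smooth \<phi> \<Longrightarrow> beta3e \<phi> = (\<lambda>x. lam^5 * (
    (1 - \<alpha>) / 3 * ((\<alpha> + 2) * \<sigma>^2 + (1 + 2 * \<alpha>) * \<sigma> * \<sigma>' - (1 + \<alpha>) / 4) * dx (dx (D \<phi>)) x
    + (1 - \<alpha>) * ((\<alpha> + 2) / 3) * \<sigma> * (\<sigma> + \<sigma>') * D (dx (dx \<phi>)) x
    - (1 - \<alpha>) * (2 * \<sigma>^2 + 2 * \<sigma> * \<sigma>' + \<sigma>'^2 - 1/4) * D (D (D \<phi>)) x))"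
  by (simp only: fun_eq_iff beta3e_rec forms2 operator_simps)
    (simp add: field_simps eval_nat_numeral)

lemma alpha4_closed: "smooth \<phi> \<Longrightarrow> alpha4 S \<phi> = (\<lambda>x. lam^4 * (
    (\<alpha> + 2) / 9 * ((\<alpha> + 2) * \<sigma>^3 - (1 - \<alpha>) * \<sigma>^2 * \<sigma>' - \<alpha> / 4 * \<sigma>) * dx (dx (dx (dx \<phi>))) x
    + (- 2 * ((\<alpha> + 2) / 3) * \<sigma>^3 + (1 - \<alpha>) / 3 * (2 * \<sigma>^2 * \<sigma>' + \<sigma> * \<sigma>'^2 - 1/4 * \<sigma>')
        + (1 + 2 * \<alpha>) / 9 * \<sigma>) * dx (dx (D (D \<phi>))) x
    + (- 2 * ((\<alpha> + 2) / 3) * \<sigma>^3 + (1 - \<alpha>) / 3 * \<sigma>^2 * \<sigma>' + (7 + 5 * \<alpha>) / 36 * \<sigma>)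
        * D (dx (dx (D \<phi>))) x
    + (\<alpha> + 2) / 3 * \<sigma> * (- 2 * \<sigma>^2 + 1/6) * D (D (dx (dx \<phi>))) x
    + \<sigma> * (5 * \<sigma>^2 - 3/4) * D (D (D (D \<phi>))) x))"
  by (simp only: fun_eq_iff alpha4_rec forms2 beta3J_closed operator_simps)
    (simp add: field_simps power2_eq_square power3_eq_cube power4_eq_xxxx)

end


section \<open>The cosine velocity field\<close>

theorem proposition4:
  fixes lam L k U \<alpha> s s' \<sigma> \<sigma>' :: real and u :: "real \<Rightarrow> real"
    and S :: scheme and Du :: "(real \<Rightarrow> real) \<Rightarrow> real \<Rightarrow> real"
  assumes "lam > 0" and "L > 0" and "k = 2 * pi / L"
    and "s \<noteq> 0" and "s' \<noteq> 0"
    and "\<sigma> = 1 / s - 1 / 2" and "\<sigma>' = 1 / s' - 1 / 2"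
    and "u = (\<lambda>x. lam * U * cos (k * x))"
    and "Du = du U k"
    and "S = d1q3 lam U k \<alpha> \<sigma> \<sigma>'"
  shows "\<forall>\<phi>. smooth \<phi> \<longrightarrow> (\<forall>x.
    alpha1 S \<phi> x = lam * Du \<phi> x
  \<and> beta1 S \<phi> x = lam^2 *\<^sub>R vector [
        u x / lam * Du \<phi> x - (\<alpha> + 2) / 3 * dx \<phi> x,
        lam * (\<alpha> - 1) * Du \<phi> x]
  \<and> alpha2 S \<phi> x = lam^2 * \<sigma> * ((Du ^^ 2) \<phi> x - (\<alpha> + 2) / 3 * (dx ^^ 2) \<phi> x)
  \<and> beta2 S \<phi> x = lam^3 *\<^sub>R vector [
        2 * \<sigma> * (u x / lam) * (Du ^^ 2) \<phi> x
        - ((\<alpha> + 2) / 3 * \<sigma> + (\<alpha> - 1) / 3 * \<sigma>') * dx (Du \<phi>) x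
        - (\<alpha> + 2) / 3 * \<sigma> * (u x / lam) * (dx ^^ 2) \<phi> x,
        lam * (\<alpha> - 1) * ((\<sigma> + \<sigma>') * (Du ^^ 2) \<phi> x - (\<alpha> + 2) / 3 * \<sigma> * (dx ^^ 2) \<phi> x)]
  \<and> alpha3 S \<phi> x = lam^3 * (
        (2 * \<sigma>^2 - 1/6) * (Du ^^ 3) \<phi> x
        + ((\<alpha> + 2) / 3 * (1/6 - \<sigma>^2) + (\<alpha> - 1) / 3 * (1/12 - \<sigma> * \<sigma>')) * (dx ^^ 2) (Du \<phi>) x
        - (\<alpha> + 2) / 3 * \<sigma>^2 * Du ((dx ^^ 2) \<phi>) x)
  \<and> beta3 S \<phi> x = vector [
        lam^4 * (
          (\<alpha> + 2) / 9 * (- (1 - \<alpha>) * \<sigma> * \<sigma>' + (\<alpha> + 2) * \<sigma>^2 + 1/4) * (dx ^^ 3) \<phi> x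
          + u x / lam * (- 2 * ((\<alpha> + 2) / 3) * \<sigma>^2 + (1 - \<alpha>) / 3 * \<sigma> * \<sigma>' + (1 + \<alpha>) / 12)
              * (dx ^^ 2) (Du \<phi>) x
          - 2 * (u x / lam) * ((\<alpha> + 2) / 3) * \<sigma>^2 * Du ((dx ^^ 2) \<phi>) x
          + (- 2 * ((\<alpha> + 2) / 3) * \<sigma>^2 + (1 - \<alpha>) / 3 * (2 * \<sigma> * \<sigma>' + \<sigma>'^2 - 1/4))
              * dx ((Du ^^ 2) \<phi>) x
          + (5 * \<sigma>^2 - 1/4) * (u x / lam) * (Du ^^ 3) \<phi> x),
        lam^5 * (
          (1 - \<alpha>) / 3 * ((\<alpha> + 2) * \<sigma>^2 + (1 + 2 * \<alpha>) * \<sigma> * \<sigma>' - (1 + \<alpha>) / 4)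
              * (dx ^^ 2) (Du \<phi>) x
          + (1 - \<alpha>) * ((\<alpha> + 2) / 3) * \<sigma> * (\<sigma> + \<sigma>') * Du ((dx ^^ 2) \<phi>) x
          - (1 - \<alpha>) * (2 * \<sigma>^2 + 2 * \<sigma> * \<sigma>' + \<sigma>'^2 - 1/4) * (Du ^^ 3) \<phi> x)]
  \<and> alpha4 S \<phi> x = lam^4 * (
        (\<alpha> + 2) / 9 * ((\<alpha> + 2) * \<sigma>^3 - (1 - \<alpha>) * \<sigma>^2 * \<sigma>' - \<alpha> / 4 * \<sigma>) * (dx ^^ 4) \<phi> x
        + (- 2 * ((\<alpha> + 2) / 3) * \<sigma>^3
            + (1 - \<alpha>) / 3 * (2 * \<sigma>^2 * \<sigma>' + \<sigma> * \<sigma>'^2 - 1/4 * \<sigma>')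
            + (1 + 2 * \<alpha>) / 9 * \<sigma>) * (dx ^^ 2) ((Du ^^ 2) \<phi>) x
        + (- 2 * ((\<alpha> + 2) / 3) * \<sigma>^3 + (1 - \<alpha>) / 3 * \<sigma>^2 * \<sigma>' + (7 + 5 * \<alpha>) / 36 * \<sigma>)
            * Du ((dx ^^ 2) (Du \<phi>)) x
        + (\<alpha> + 2) / 3 * \<sigma> * (- 2 * \<sigma>^2 + 1/6) * (Du ^^ 2) ((dx ^^ 2) \<phi>) x
        + \<sigma> * (5 * \<sigma>^2 - 3/4) * (Du ^^ 4) \<phi> x))"
proof -
  define V where "V = (\<lambda>x. U * cos (k * x))"
  interpret d1q3_flow lam \<alpha> \<sigma> \<sigma>' V S
    by unfold_locales (simp_all add: V_def smooth_mult smooth_const smooth_cos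
        \<open>S = _\<close> d1q3_def mult.assoc)
  \<comment> \<open>The default value of \<open>deriv\<close> need not scale with \<open>U\<close>, so agreement needs
      differentiability of \<open>f\<close>.\<close>
  have Du: "Du f = D f" if "smooth f" for f
  proof -
    have "dx (\<lambda>x. U * (cos (k * x) * f x)) = Du f"
      unfolding \<open>Du = _\<close> du_def using that
      by (intro dx_cmult smooth_mult smooth_cos)
    then show ?thesis
      unfolding D_def by (simp add: V_def mult.assoc)
  qed
  have u: "u x / lam = V x" for x
    using \<open>lam > 0\<close> by (simp add: \<open>u = _\<close> V_def)
  have beta: "beta1 S \<phi> x = vector [beta1J \<phi> x, beta1e \<phi> x]"
    "beta2 S \<phi> x = vector [beta2J \<phi> x, beta2e \<phi> x]"
    "beta3 S \<phi> x = vector [beta3J \<phi> x, beta3e \<phi> x]" for \<phi> x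
    by (simp_all add: vec_eq_iff forall_2 vector_2 component_defs)
  have powers: "(f ^^ 2) g = f (f g)" "(f ^^ 3) g = f (f (f g))" "(f ^^ 4) g = f (f (f (f g)))"
    for f :: "(real \<Rightarrow> real) \<Rightarrow> real \<Rightarrow> real" and g
    by (simp_all add: eval_nat_numeral)
  show ?thesis
    unfolding u beta powers
    by (simp add: Du smooth_D smooth_deriv forms2 beta3J_closed beta3e_closed alpha4_closed
        vec_eq_iff forall_2 vector_2)
      (simp add: algebra_simps eval_nat_numeral)
qed

end
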